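(* Let $\omega\in\Omega^V$. Then $\omega\in\Omega_V$ if and only if $\omega$ is $V$-variable, i.e. for every level $k$ the set of all subtrees at level $k$ of all components of $\omega$ has at most $V$ distinct elements. Also, if $\sigma\in\Omega$, then $\sigma$ is a $V$-tree (i.e. $\sigma\in\Omega_{V,1}$) if and only if $\sigma$ is $V$-variable, i.e. for every level $k$ the code tree $\sigma$ has at most $V$ distinct subtrees at level $k$.
   Context: Code trees. $M,N,V$ are positive integers with $M\ge 2$. $T$ is the set of all finite sequences over $\{1,\dots,M\}$, including the empty sequence $\emptyset$; $|i|$ is the length of $i\in T$ and $ij$ denotes concatenation. A code tree is a function $\tau:T\to\{1,\dots,N\}$; $\Omega$ is the set of all code trees with metric $d_\Omega(\omega,\varkappa)=M^{-k}$ for $\omega\ne\varkappa$, where $k$ is the least integer such that $\omega(i)\neq\varkappa(i)$ for some $i\in T$ with $|i|=k$. $\Omega^V$ is the $V$-fold product with the maximum metric. For $\tau\in\Omega$ and $i\in T$ with $|i|=k$, the code tree $j\mapsto\tau(ij)$, $j\in T$, is called a subtree of $\tau$ at level $k$. The set $\Omega_V$. $\mathcal{A}=\{\{1,\dots,N\}\times\{1,\dots,V\}^M\}^V$; write $a=(a_1,\dots,a_V)\in\mathcal{A}$ with $a_v=(n_v;v_{v,1},\dots,v_{v,M})$. For $n\in\{1,\dots,N\}$ define $\xi_n:\Omega^M\to\Omega$ by $(\xi_n(\omega))(\emptyset)=n$ and $(\xi_n(\omega))(mi)=\omega_m(i)$ for $i\in T$, $m\in\{1,\dots,M\}$. For $a\in\mathcal{A}$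 define $\eta^a:\Omega^V\to\Omega^V$ by letting the $v$-th component of $\eta^a(\omega_1,\dots,\omega_V)$ be $\xi_{n_v}(\omega_{v_{v,1}},\dots,\omega_{v_{v,M}})$; each $\eta^a$ is a contraction. $\Omega_V$ is the set attractor of the IFS $\{\Omega^V;\eta^a,a\in\mathcal{A}\}$, i.e. the unique non-empty compact subset of $\Omega^V$ with $\Omega_V=\bigcup_{a\in\mathcal{A}}\eta^a(\Omega_V)$. $\Omega_{V,1}\subset\Omega$ is the set of first components of elements of $\Omega_V$; its elements are called $V$-trees. *)

theory Defs
  imports "HOL-Analysis.Abstract_Metric_Spaces" "HOL-Library.FuncSet"
begin

text \<open>
  Throughout, maps with a prescribed domain are elements of the extensional function space
  \<open>\<rightarrow>\<^sub>E\<close>, so that equality in HOL is equality on the domain.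
\<close>

definition addresses :: "nat \<Rightarrow> nat list set" where
  "addresses M = lists {1..M}"

definition code_trees :: "nat \<Rightarrow> nat \<Rightarrow> (nat list \<Rightarrow> nat) set" where
  "code_trees M N = addresses M \<rightarrow>\<^sub>E {1..N}"

definition tree_dist :: "nat \<Rightarrow> (nat list \<Rightarrow> nat) \<Rightarrow> (nat list \<Rightarrow> nat) \<Rightarrow> real" where
  "tree_dist M \<omega> \<kappa> =
     (if \<omega> = \<kappa> then 0
      else 1 / real M ^ (LEAST k. \<exists>i\<in>addresses M. length i = k \<and> \<omega> i \<noteq> \<kappa> i))"

definition tree_tuples :: "nat \<Rightarrow> nat \<Rightarrow> nat \<Rightarrow> (nat \<Rightarrow> nat list \<Rightarrow> nat) set" where
  "tree_tuples M N V = {1..V} \<rightarrow>\<^sub>E code_trees M N"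

definition tuple_dist ::
  "nat \<Rightarrow> nat \<Rightarrow> (nat \<Rightarrow> nat list \<Rightarrow> nat) \<Rightarrow> (nat \<Rightarrow> nat list \<Rightarrow> nat) \<Rightarrow> real" where
  "tuple_dist M V \<omega> \<kappa> = Max ((\<lambda>v. tree_dist M (\<omega> v) (\<kappa> v)) ` {1..V})"

definition subtree :: "nat \<Rightarrow> (nat list \<Rightarrow> nat) \<Rightarrow> nat list \<Rightarrow> nat list \<Rightarrow> nat" where
  "subtree M \<tau> i = (\<lambda>j\<in>addresses M. \<tau> (i @ j))"

definition subtrees_at_level :: "nat \<Rightarrow> (nat list \<Rightarrow> nat) \<Rightarrow> nat \<Rightarrow> (nat list \<Rightarrow> nat) set" where
  "subtrees_at_level M \<tau> k = {subtree M \<tau> i | i. i \<in> addresses M \<and> length i = k}"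

text \<open>
  An index \<open>a\<close> of the iterated function system assigns to \<open>v\<close> the pair consisting of \<open>n\<^sub>v\<close> and
  the tuple \<open>m \<mapsto> v\<^bsub>v,m\<^esub>\<close>.
\<close>

definition ifs_indices :: "nat \<Rightarrow> nat \<Rightarrow> nat \<Rightarrow> (nat \<Rightarrow> nat \<times> (nat \<Rightarrow> nat)) set" where
  "ifs_indices M N V = {1..V} \<rightarrow>\<^sub>E ({1..N} \<times> ({1..M} \<rightarrow>\<^sub>E {1..V}))"

definition xi :: "nat \<Rightarrow> nat \<Rightarrow> (nat \<Rightarrow> nat list \<Rightarrow> nat) \<Rightarrow> nat list \<Rightarrow> nat" where
  "xi M n \<omega> = (\<lambda>j\<in>addresses M. case j of [] \<Rightarrow> n | m # i \<Rightarrow> \<omega> m i)"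

definition eta ::
  "nat \<Rightarrow> nat \<Rightarrow> (nat \<Rightarrow> nat \<times> (nat \<Rightarrow> nat)) \<Rightarrow> (nat \<Rightarrow> nat list \<Rightarrow> nat) \<Rightarrow> nat \<Rightarrow> nat list \<Rightarrow> nat"
  where
  "eta M V a \<omega> = (\<lambda>v\<in>{1..V}. xi M (fst (a v)) (\<lambda>m\<in>{1..M}. \<omega> (snd (a v) m)))"

text \<open>\<^const>\<open>compactin\<close> already forces \<open>K \<subseteq> X\<close>.\<close>

definition ifs_attractor ::
  "'a set \<Rightarrow> ('a \<Rightarrow> 'a \<Rightarrow> real) \<Rightarrow> 'i set \<Rightarrow> ('i \<Rightarrow> 'a \<Rightarrow> 'a) \<Rightarrow> 'a set" where
  "ifs_attractor X d I f =
     (THE K. K \<noteq> {} \<and> compactin (Metric_space.mtopology X d) K \<and> K = (\<Union>a\<in>I. f a ` K))"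

definition Omega_V :: "nat \<Rightarrow> nat \<Rightarrow> nat \<Rightarrow> (nat \<Rightarrow> nat list \<Rightarrow> nat) set" where
  "Omega_V M N V =
     ifs_attractor (tree_tuples M N V) (tuple_dist M V) (ifs_indices M N V) (eta M V)"

definition V_trees :: "nat \<Rightarrow> nat \<Rightarrow> nat \<Rightarrow> (nat list \<Rightarrow> nat) set" where
  "V_trees M N V = (\<lambda>\<omega>. \<omega> 1) ` Omega_V M N V"

text \<open>
  There are only finitely many addresses of a given length, so the sets whose cardinality is
  taken below are finite and \<^const>\<open>card\<close> has its usual meaning.
\<close>

definition V_variable_tuple :: "nat \<Rightarrow> nat \<Rightarrow> (nat \<Rightarrow> nat list \<Rightarrow> nat) \<Rightarrow> bool" where
  "V_variable_tuple M V \<omega> \<longleftrightarrow> (\<forall>k. card (\<Union>v\<in>{1..V}. subtrees_at_level M (\<omega> v) k) \<le> V)"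

definition V_variable_tree :: "nat \<Rightarrow> nat \<Rightarrow> (nat list \<Rightarrow> nat) \<Rightarrow> bool" where
  "V_variable_tree M V \<sigma> \<longleftrightarrow> (\<forall>k. card (subtrees_at_level M \<sigma> k) \<le> V)"

lemma finite_subtrees_at_level: "finite (subtrees_at_level M \<tau> k)"
  unfolding subtrees_at_level_def addresses_def lists_eq_set mem_Collect_eq
  by (intro finite_image_set finite_lists_length_eq) simp

lemma xi_in_code_trees:
  assumes "n \<in> {1..N}" "\<omega> \<in> {1..M} \<rightarrow>\<^sub>E code_trees M N"
  shows "xi M n \<omega> \<in> code_trees M N"
proof -
  have "\<omega> m i \<in> {1..N}" if "m # i \<in> addresses M" for m i
  proof -
    have mi: "m \<in> {1..M}" "i \<in> addresses M"
      using that by (auto simp: addresses_def)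
    have "\<omega> m \<in> addresses M \<rightarrow>\<^sub>E {1..N}"
      using assms(2) mi(1) unfolding code_trees_def by (rule PiE_mem)
    then show ?thesis using mi(2) by (rule PiE_mem)
  qed
  then show ?thesis
    using assms(1) unfolding xi_def code_trees_def by (auto split: list.split simp: PiE_iff)
qed

lemma eta_in_tree_tuples:
  assumes a: "a \<in> ifs_indices M N V" and w: "\<omega> \<in> tree_tuples M N V"
  shows "eta M V a \<omega> \<in> tree_tuples M N V"
proof -
  have "xi M (fst (a v)) (\<lambda>m\<in>{1..M}. \<omega> (snd (a v) m)) \<in> code_trees M N" if v: "v \<in> {1..V}" for v
  proof (rule xi_in_code_trees)
    have av: "a v \<in> {1..N} \<times> ({1..M} \<rightarrow>\<^sub>E {1..V})"
      using a v unfolding ifs_indices_def by (rule PiE_mem)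
    then show "fst (a v) \<in> {1..N}" by auto
    show "(\<lambda>m\<in>{1..M}. \<omega> (snd (a v) m)) \<in> {1..M} \<rightarrow>\<^sub>E code_trees M N"
    proof (rule restrict_PiE_iff[THEN iffD2], rule ballI)
      fix m assume "m \<in> {1..M}"
      then have "snd (a v) m \<in> {1..V}" using av by (auto simp: mem_Times_iff dest: PiE_mem)
      then show "\<omega> (snd (a v) m) \<in> code_trees M N"
        using w unfolding tree_tuples_def by (rule PiE_mem[rotated])
    qed
  qed
  then show ?thesis unfolding eta_def tree_tuples_def by (auto simp: restrict_PiE_iff)
qed

lemma tree_dist_le_iff:
  assumes M: "M \<ge> 2" and w: "\<omega> \<in> code_trees M N" and x: "\<kappa> \<in> code_trees M N"
  shows "tree_dist M \<omega> \<kappa> \<le> 1 / real M ^ k \<longleftrightarrow> (\<forall>i\<in>addresses M. length i < k \<longrightarrow> \<omega> i = \<kappa> i)"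
proof (cases "\<omega> = \<kappa>")
  case True
  then show ?thesis by (simp add: tree_dist_def)
next
  case False
  let ?P = "\<lambda>k. \<exists>i\<in>addresses M. length i = k \<and> \<omega> i \<noteq> \<kappa> i"
  obtain i where "i \<in> addresses M" "\<omega> i \<noteq> \<kappa> i"
    using False PiE_ext[OF w[unfolded code_trees_def] x[unfolded code_trees_def]] by blast
  then have ex: "?P (length i)" by blast
  have "tree_dist M \<omega> \<kappa> \<le> 1 / real M ^ k \<longleftrightarrow> real M ^ k \<le> real M ^ (LEAST k. ?P k)"
    using False M by (simp add: tree_dist_def field_simps)
  also have "\<dots> \<longleftrightarrow> k \<le> (LEAST k. ?P k)"
    using M by (simp add: power_increasing_iff)
  also have "\<dots> \<longleftrightarrow> (\<forall>i\<in>addresses M. length i < k \<longrightarrow> \<omega> i = \<kappa> i)"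
  proof
    assume le: "k \<le> (LEAST k. ?P k)"
    show "\<forall>i\<in>addresses M. length i < k \<longrightarrow> \<omega> i = \<kappa> i"
    proof (intro ballI impI)
      fix i assume i: "i \<in> addresses M" "length i < k"
      from i(2) le have "length i < (LEAST k. ?P k)" by (rule order_less_le_trans)
      then have "\<not> ?P (length i)" by (rule not_less_Least)
      with i(1) show "\<omega> i = \<kappa> i" by blast
    qed
  next
    assume eq: "\<forall>i\<in>addresses M. length i < k \<longrightarrow> \<omega> i = \<kappa> i"
    have "?P (LEAST k. ?P k)" by (rule LeastI[of ?P]) (rule ex)
    then obtain i where i: "i \<in> addresses M" "length i = (LEAST k. ?P k)" "\<omega> i \<noteq> \<kappa> i"
      by blast
    with eq have "\<not> length i < k" by blast
    then show "k \<le> (LEAST k. ?P k)" unfolding i(2) by (rule leI)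
  qed
  finally show ?thesis .
qed

lemma tree_dist_cases: "tree_dist M \<omega> \<kappa> = 0 \<and> \<omega> = \<kappa> \<or> (\<exists>k. tree_dist M \<omega> \<kappa> = 1 / real M ^ k)"
  unfolding tree_dist_def by auto

lemma tree_dist_ultra:
  assumes M: "M \<ge> 2" and "x \<in> code_trees M N" "y \<in> code_trees M N" "z \<in> code_trees M N"
  shows "tree_dist M x z \<le> max (tree_dist M x y) (tree_dist M y z)"
proof -
  consider "x = y" | "y = z" | k l where "tree_dist M x y = 1 / real M ^ k" "tree_dist M y z = 1 / real M ^ l"
    using tree_dist_cases[of M x y] tree_dist_cases[of M y z] by blast
  then show ?thesis
  proof cases
    case 3
    define j where "j = min k l"
    have "1 / real M ^ k \<le> 1 / real M ^ j" "1 / real M ^ l \<le> 1 / real M ^ j"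
      using M by (auto simp: j_def field_simps intro!: power_increasing)
    then have "tree_dist M x y \<le> 1 / real M ^ j" "tree_dist M y z \<le> 1 / real M ^ j"
      using 3 by auto
    then have "tree_dist M x z \<le> 1 / real M ^ j"
      using assms(2-4) by (simp add: tree_dist_le_iff[OF M, where N = N])
    also have "\<dots> \<le> max (tree_dist M x y) (tree_dist M y z)"
      using 3 by (auto simp: j_def min_def)
    finally show ?thesis .
  qed auto
qed

lemma Metric_space_code_trees:
  assumes M: "M \<ge> 2"
  shows "Metric_space (code_trees M N) (tree_dist M)"
proof
  fix x y :: "nat list \<Rightarrow> nat"
  show "0 \<le> tree_dist M x y" by (simp add: tree_dist_def)
  have "(x i \<noteq> y i) = (y i \<noteq> x i)" for i by auto
  then show "tree_dist M x y = tree_dist M y x" unfolding tree_dist_def by presburger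
  show "tree_dist M x y = 0 \<longleftrightarrow> x = y" using M by (simp add: tree_dist_def)
next
  fix x y z assume *: "x \<in> code_trees M N" "y \<in> code_trees M N" "z \<in> code_trees M N"
  have "0 \<le> tree_dist M x y" "0 \<le> tree_dist M y z" by (auto simp: tree_dist_def)
  with tree_dist_ultra[OF M *] show "tree_dist M x z \<le> tree_dist M x y + tree_dist M y z" by linarith
qed

lemma Metric_space_tree_tuples:
  assumes M: "M \<ge> 2" and V: "V \<ge> 1"
  shows "Metric_space (tree_tuples M N V) (tuple_dist M V)"
proof -
  interpret T: Metric_space "code_trees M N" "tree_dist M" by (rule Metric_space_code_trees[OF M])
  have ne: "{1..V} \<noteq> {}" using V by auto
  have le: "tree_dist M (x v) (y v) \<le> tuple_dist M V x y" if "v \<in> {1..V}" for x y v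
    using that unfolding tuple_dist_def by (intro Max_ge) auto
  have leI: "tuple_dist M V x y \<le> c" if "\<And>v. v \<in> {1..V} \<Longrightarrow> tree_dist M (x v) (y v) \<le> c" for x y c
    using that ne unfolding tuple_dist_def by (subst Max_le_iff) auto
  have mem: "x v \<in> code_trees M N" if "x \<in> tree_tuples M N V" "v \<in> {1..V}" for x v
    using that unfolding tree_tuples_def by (rule PiE_mem)
  have nonneg: "0 \<le> tuple_dist M V x y" for x y
  proof -
    have "1 \<in> {1..V}" using V by simp
    from order_trans[OF T.nonneg le[OF this]] show ?thesis .
  qed
  show ?thesis
  proof
    fix x y :: "nat \<Rightarrow> nat list \<Rightarrow> nat"
    show "0 \<le> tuple_dist M V x y" by (rule nonneg)
    show "tuple_dist M V x y = tuple_dist M V y x" by (simp add: tuple_dist_def T.commute)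
  next
    fix x y assume x: "x \<in> tree_tuples M N V" and y: "y \<in> tree_tuples M N V"
    show "tuple_dist M V x y = 0 \<longleftrightarrow> x = y"
    proof
      assume "tuple_dist M V x y = 0"
      then have "x v = y v" if v: "v \<in> {1..V}" for v
        using le[OF v, of x y] T.nonneg[of "x v" "y v"] T.zero[OF mem[OF x v] mem[OF y v]] by simp
      then show "x = y" using x y unfolding tree_tuples_def by (rule PiE_ext[rotated 2])
    next
      assume "x = y"
      then have "tuple_dist M V x y \<le> 0" by (intro leI) (simp add: tree_dist_def)
      with nonneg[of x y] show "tuple_dist M V x y = 0" by simp
    qed
  next
    fix x y z
    assume x: "x \<in> tree_tuples M N V" and y: "y \<in> tree_tuples M N V" and z: "z \<in> tree_tuples M N V"
    show "tuple_dist M V x z \<le> tuple_dist M V x y + tuple_dist M V y z"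
    proof (rule leI)
      fix v assume v: "v \<in> {1..V}"
      show "tree_dist M (x v) (z v) \<le> tuple_dist M V x y + tuple_dist M V y z"
        using T.triangle[OF mem[OF x v] mem[OF y v] mem[OF z v]] le[OF v, of x y] le[OF v, of y z]
        by linarith
    qed
  qed
qed

end

theory Submission
  imports Defs
begin

text \<open>
  Call a tuple variable if it is \<open>V\<close>-variable. The set of variable tuples is closed, hence compact,
  because distinct subtrees are already distinguished at finite depth. It is invariant under the
  iterated function system: applying \<open>\<eta>\<^sup>a\<close> pushes the subtrees one level down, and conversely the at
  most \<open>V\<close> subtrees at level 1 of a variable tuple can be listed as a new tuple.
  Any non-empty compact invariant set \<open>K\<close> equals it: iterating \<open>K = \<Union>\<eta>\<^sup>a(K)\<close> shows that level-\<open>k\<close>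
  subtrees of a member of \<open>K\<close> are components of another member, so there are at most \<open>V\<close> of them;
  and a variable tuple agrees with members of \<open>K\<close> up to any given level, so it lies in the closed set \<open>K\<close>.
\<close>

subsection \<open>Addresses, subtrees and the maps of the iterated function system\<close>

lemma Nil_in_addresses [simp]: "[] \<in> addresses M"
  by (simp add: addresses_def)

lemma Cons_in_addresses [simp]: "m # i \<in> addresses M \<longleftrightarrow> m \<in> {1..M} \<and> i \<in> addresses M"
  by (auto simp: addresses_def)

lemma append_in_addresses [simp]: "i @ j \<in> addresses M \<longleftrightarrow> i \<in> addresses M \<and> j \<in> addresses M"
  by (auto simp: addresses_def)

lemma finite_addresses_below: "finite {i \<in> addresses M. length i < k}"
proof (rule finite_subset)
  show "{i \<in> addresses M. length i < k} \<subseteq> {i. set i \<subseteq> {1..M} \<and> length i \<le> k}"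
    by (auto simp: addresses_def)
qed (simp add: finite_lists_length_le)

lemma subtree_subtree:
  assumes "j \<in> addresses M"
  shows "subtree M (subtree M \<tau> i) j = subtree M \<tau> (i @ j)"
  using assms by (auto simp: subtree_def fun_eq_iff)

lemma subtree_in_code_trees:
  assumes "\<tau> \<in> code_trees M N" "i \<in> addresses M"
  shows "subtree M \<tau> i \<in> code_trees M N"
  using assms unfolding subtree_def code_trees_def by (auto simp: PiE_iff)

definition component_subtrees ::
  "nat \<Rightarrow> nat \<Rightarrow> (nat \<Rightarrow> nat list \<Rightarrow> nat) \<Rightarrow> nat \<Rightarrow> (nat list \<Rightarrow> nat) set" where
  "component_subtrees M V \<omega> k = (\<Union>v\<in>{1..V}. subtrees_at_level M (\<omega> v) k)"

lemma V_variable_tuple_iff: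
  "V_variable_tuple M V \<omega> \<longleftrightarrow> (\<forall>k. card (component_subtrees M V \<omega> k) \<le> V)"
  by (simp add: V_variable_tuple_def component_subtrees_def)

text \<open>Indexing by pairs of component and address turns the union into the image of one set,
  from which representatives can be chosen.\<close>

lemma component_subtrees_conv_image:
  "component_subtrees M V \<omega> k =
     (\<lambda>(v, i). subtree M (\<omega> v) i) ` ({1..V} \<times> {i \<in> addresses M. length i = k})"
  unfolding component_subtrees_def subtrees_at_level_def by auto

lemma finite_component_subtrees: "finite (component_subtrees M V \<omega> k)"
  unfolding component_subtrees_def by (simp add: finite_subtrees_at_level)

text \<open>The empty address is the only one of length 0, so the condition at level 0 holds for
  every tuple. This settles level 0 whenever levels are treated by cases or by induction.\<close>

lemma card_component_subtrees_0: "card (component_subtrees M V \<omega> 0) \<le> V"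
proof -
  have "component_subtrees M V \<omega> 0 \<subseteq> (\<lambda>v. subtree M (\<omega> v) []) ` {1..V}"
    by (auto simp: component_subtrees_conv_image)
  from surj_card_le[OF _ this] show ?thesis by simp
qed

lemma tree_tuples_component:
  "\<omega> \<in> tree_tuples M N V \<Longrightarrow> v \<in> {1..V} \<Longrightarrow> \<omega> v \<in> code_trees M N"
  unfolding tree_tuples_def by (rule PiE_mem)

lemma eta_Nil: "v \<in> {1..V} \<Longrightarrow> eta M V a \<omega> v [] = fst (a v)"
  by (simp add: eta_def xi_def)

lemma eta_Cons:
  "\<lbrakk>v \<in> {1..V}; m \<in> {1..M}; i \<in> addresses M\<rbrakk> \<Longrightarrow> eta M V a \<omega> v (m # i) = \<omega> (snd (a v) m) i"
  by (simp add: eta_def xi_def)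

lemma subtree_eta_Cons:
  "\<lbrakk>v \<in> {1..V}; m \<in> {1..M}; i \<in> addresses M\<rbrakk> \<Longrightarrow>
    subtree M (eta M V a \<omega> v) (m # i) = subtree M (\<omega> (snd (a v) m)) i"
  by (auto simp: subtree_def eta_Cons)

lemma ifs_indices_mem:
  assumes "a \<in> ifs_indices M N V" "v \<in> {1..V}"
  shows "fst (a v) \<in> {1..N}" "m \<in> {1..M} \<Longrightarrow> snd (a v) m \<in> {1..V}"
proof -
  have "a v \<in> {1..N} \<times> ({1..M} \<rightarrow>\<^sub>E {1..V})"
    using assms unfolding ifs_indices_def by (rule PiE_mem)
  then show "fst (a v) \<in> {1..N}" "m \<in> {1..M} \<Longrightarrow> snd (a v) m \<in> {1..V}"
    by (auto simp: mem_Times_iff dest: PiE_mem)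
qed

text \<open>An address of length \<open>Suc k\<close> starts with a letter \<open>m\<close>; below
  \<open>m\<close>, component \<open>v\<close> of the image is a copy of component
  \<open>snd (a v) m\<close> of \<open>\<omega>\<close>. The inclusion can be strict, since
  \<open>a\<close> may leave some components of \<open>\<omega>\<close> out.\<close>

lemma component_subtrees_eta:
  assumes "a \<in> ifs_indices M N V"
  shows "component_subtrees M V (eta M V a \<omega>) (Suc k) \<subseteq> component_subtrees M V \<omega> k"
proof
  fix t assume "t \<in> component_subtrees M V (eta M V a \<omega>) (Suc k)"
  then obtain v m i where *: "v \<in> {1..V}" "m \<in> {1..M}" "i \<in> addresses M" "length i = k"
    and t: "t = subtree M (eta M V a \<omega> v) (m # i)"
    by (fastforce simp: component_subtrees_conv_image length_Suc_conv)
  have "snd (a v) m \<in> {1..V}" using assms *(1,2) by (rule ifs_indices_mem(2))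
  moreover have "t = subtree M (\<omega> (snd (a v) m)) i" using t * by (simp add: subtree_eta_Cons)
  ultimately show "t \<in> component_subtrees M V \<omega> k"
    using * unfolding component_subtrees_conv_image by (auto intro!: image_eqI[of _ _ "(snd (a v) m, i)"])
qed

subsection \<open>Agreement up to a level and the topology of tree tuples\<close>

text \<open>The combinatorial form of distance at most \<open>1 / real M ^ k\<close>. The strict
  bound on the length makes the case \<open>k = 0\<close> vacuous, which starts the later
  induction.\<close>

definition agree_below ::
  "nat \<Rightarrow> nat \<Rightarrow> nat \<Rightarrow> (nat \<Rightarrow> nat list \<Rightarrow> nat) \<Rightarrow> (nat \<Rightarrow> nat list \<Rightarrow> nat) \<Rightarrow> bool" where
  "agree_below M V k \<omega> \<kappa> \<longleftrightarrow> (\<forall>v\<in>{1..V}. \<forall>i\<in>addresses M. length i < k \<longrightarrow> \<omega> v i = \<kappa> v i)"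

lemma tuple_dist_le_iff:
  assumes "M \<ge> 2" "V \<ge> 1" "\<omega> \<in> tree_tuples M N V" "\<kappa> \<in> tree_tuples M N V"
  shows "tuple_dist M V \<omega> \<kappa> \<le> 1 / real M ^ k \<longleftrightarrow> agree_below M V k \<omega> \<kappa>"
proof -
  have "tuple_dist M V \<omega> \<kappa> \<le> 1 / real M ^ k \<longleftrightarrow>
      (\<forall>v\<in>{1..V}. tree_dist M (\<omega> v) (\<kappa> v) \<le> 1 / real M ^ k)"
    using assms(2) unfolding tuple_dist_def by (subst Max_le_iff) auto
  also have "\<dots> \<longleftrightarrow> agree_below M V k \<omega> \<kappa>"
    unfolding agree_below_def
    using assms by (intro ball_cong refl tree_dist_le_iff) (auto intro: tree_tuples_component)
  finally show ?thesis .
qed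

lemma ex_inverse_power_less:
  assumes "M \<ge> 2" "\<epsilon> > 0"
  obtains k where "1 / real M ^ k < \<epsilon>"
proof -
  obtain k where "inverse \<epsilon> < real M ^ k"
    using real_arch_pow[of "real M" "inverse \<epsilon>"] assms by auto
  then have "1 / real M ^ k < \<epsilon>" using assms by (simp add: field_simps)
  then show ?thesis by (rule that)
qed

text \<open>The radii \<open>1 / real M ^ k\<close> become arbitrarily small, so balls can be
  replaced by agreement below \<open>k\<close>. Closedness then becomes a statement about labels
  alone.\<close>

lemma closedin_tree_tuples_iff:
  assumes "M \<ge> 2" "V \<ge> 1" "C \<subseteq> tree_tuples M N V"
  shows "closedin (Metric_space.mtopology (tree_tuples M N V) (tuple_dist M V)) C \<longleftrightarrow>
    (\<forall>\<omega>\<in>tree_tuples M N V. (\<forall>k. \<exists>\<kappa>\<in>C. agree_below M V k \<omega> \<kappa>) \<longrightarrow> \<omega> \<in> C)"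
proof -
  interpret Metric_space "tree_tuples M N V" "tuple_dist M V"
    using assms by (intro Metric_space_tree_tuples)
  have "(\<exists>r>0. disjnt C (mball \<omega> r)) \<longleftrightarrow> (\<exists>k. \<forall>\<kappa>\<in>C. \<not> agree_below M V k \<omega> \<kappa>)"
    if w: "\<omega> \<in> tree_tuples M N V" for \<omega>
  proof
    assume "\<exists>r>0. disjnt C (mball \<omega> r)"
    then obtain r where r: "r > 0" "disjnt C (mball \<omega> r)" by blast
    obtain k where k: "1 / real M ^ k < r" using ex_inverse_power_less assms(1) r(1) .
    have "\<not> agree_below M V k \<omega> \<kappa>" if c: "\<kappa> \<in> C" for \<kappa>
    proof
      assume "agree_below M V k \<omega> \<kappa>"
      with tuple_dist_le_iff[OF assms(1,2) w] c assms(3) have "tuple_dist M V \<omega> \<kappa> \<le> 1 / real M ^ k"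
        by blast
      with k c w assms(3) r(2) show False by (fastforce simp: disjnt_iff)
    qed
    then show "\<exists>k. \<forall>\<kappa>\<in>C. \<not> agree_below M V k \<omega> \<kappa>" by blast
  next
    assume "\<exists>k. \<forall>\<kappa>\<in>C. \<not> agree_below M V k \<omega> \<kappa>"
    then obtain k where k: "\<forall>\<kappa>\<in>C. \<not> agree_below M V k \<omega> \<kappa>" by blast
    \<comment> \<open>A point of this open ball has distance below \<open>1 / real M ^ k\<close>,
      hence agrees with \<open>\<omega>\<close> below \<open>k\<close>.\<close>
    have "disjnt C (mball \<omega> (1 / real M ^ k))"
      using k tuple_dist_le_iff[OF assms(1,2) w] by (fastforce simp: disjnt_iff)
    moreover have "1 / real M ^ k > 0" using assms(1) by simp
    ultimately show "\<exists>r>0. disjnt C (mball \<omega> r)" by blast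
  qed
  then show ?thesis unfolding closedin_metric using assms(3) by blast
qed

section \<open>Compactness of the space of tree tuples\<close>

text \<open>A tuple of trees is a curried family of labels. The space is therefore a continuous
  image of a product of finite discrete spaces, which is compact by Tychonoff's theorem.\<close>

lemma compact_space_tree_tuples:
  assumes "M \<ge> 2" "V \<ge> 1"
  shows "compact_space (Metric_space.mtopology (tree_tuples M N V) (tuple_dist M V))"
proof -
  interpret Metric_space "tree_tuples M N V" "tuple_dist M V"
    using assms by (intro Metric_space_tree_tuples)
  define I where "I = {1..V} \<times> addresses M"
  define P where "P = product_topology (\<lambda>_. discrete_topology {1..N}) I"
  define F :: "(nat \<times> nat list \<Rightarrow> nat) \<Rightarrow> nat \<Rightarrow> nat list \<Rightarrow> nat"
    where "F x = (\<lambda>v\<in>{1..V}. \<lambda>i\<in>addresses M. x (v, i))" for x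
  have P_top: "topspace P = I \<rightarrow>\<^sub>E {1..N}" by (simp add: P_def)
  have F_in: "F x \<in> tree_tuples M N V" if "x \<in> topspace P" for x
    using that unfolding P_top F_def I_def tree_tuples_def code_trees_def by (auto simp: PiE_iff)
  have "compact_space P"
    unfolding P_def compact_space_product_topology by (simp add: compact_space_discrete_topology)
  moreover have "continuous_map P mtopology F"
    unfolding continuous_map_to_metric
  proof (intro ballI allI impI)
    fix x and \<epsilon> :: real assume x: "x \<in> topspace P" and e: "\<epsilon> > 0"
    obtain k where k: "1 / real M ^ k < \<epsilon>" using ex_inverse_power_less assms(1) e .
    \<comment> \<open>A cylinder around \<open>x\<close>: labels at depth below \<open>k\<close> are
      fixed, all others are free. Only finitely many coordinates are constrained, so
      \<open>U\<close> is open in the product.\<close>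
    define W where "W = (\<lambda>(v, i). if length i < k then {x (v, i)} else {1..N})"
    define U where "U = PiE I W"
    have W_sub: "W p \<subseteq> {1..N}" if "p \<in> I" for p
      using x that unfolding P_top W_def by (auto simp: PiE_iff split: prod.splits if_splits)
    have "{p \<in> I. W p \<noteq> {1..N}} \<subseteq> {1..V} \<times> {i \<in> addresses M. length i < k}"
      by (auto simp: I_def W_def split: if_splits)
    then have "finite {p \<in> I. W p \<noteq> {1..N}}"
      using finite_addresses_below by (rule finite_subset[OF _ finite_cartesian_product[OF finite_atLeastAtMost]])
    with W_sub have "openin P U" by (simp add: P_def U_def openin_PiE_gen)
    moreover have "x \<in> U"
      using x unfolding U_def P_top W_def by (auto simp: PiE_iff)
    moreover have "F y \<in> mball (F x) \<epsilon>" if y: "y \<in> U" for y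
    proof -
      have yP: "y \<in> topspace P" using y \<open>openin P U\<close> openin_subset by blast
      have "y (v, i) = x (v, i)" if "v \<in> {1..V}" "i \<in> addresses M" "length i < k" for v i
        using PiE_mem[OF y[unfolded U_def], of "(v, i)"] that by (simp add: I_def W_def)
      then have "agree_below M V k (F x) (F y)" by (simp add: agree_below_def F_def)
      then have "tuple_dist M V (F x) (F y) \<le> 1 / real M ^ k"
        using tuple_dist_le_iff[OF assms F_in[OF x] F_in[OF yP]] by blast
      with k F_in[OF x] F_in[OF yP] show ?thesis by simp
    qed
    ultimately show "\<exists>U. openin P U \<and> x \<in> U \<and> (\<forall>y\<in>U. F y \<in> mball (F x) \<epsilon>)" by blast
  qed
  ultimately have "compactin mtopology (F ` topspace P)"
    unfolding compact_space_def by (rule image_compactin)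
  moreover have "F ` topspace P = tree_tuples M N V"
  proof
    show "F ` topspace P \<subseteq> tree_tuples M N V" using F_in by blast
    show "tree_tuples M N V \<subseteq> F ` topspace P"
    proof
      fix \<omega> assume w: "\<omega> \<in> tree_tuples M N V"
      define x where "x = (\<lambda>(v, i)\<in>I. \<omega> v i)"
      have w': "\<omega> v \<in> addresses M \<rightarrow>\<^sub>E {1..N}" if "v \<in> {1..V}" for v
        using tree_tuples_component[OF w that] by (simp add: code_trees_def)
      have x: "x \<in> topspace P" using w' unfolding P_top x_def I_def by (auto simp: PiE_iff)
      moreover have "\<omega> = F x"
      proof (rule PiE_ext[OF w[unfolded tree_tuples_def] F_in[OF x, unfolded tree_tuples_def]])
        fix v assume v: "v \<in> {1..V}"
        then show "\<omega> v = F x v"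
          using w'[OF v] by (auto simp: F_def x_def I_def PiE_iff extensional_def fun_eq_iff)
      qed
      ultimately show "\<omega> \<in> F ` topspace P" by blast
    qed
  qed
  ultimately show ?thesis by (simp add: compact_space_def)
qed

subsection \<open>The set of variable tuples\<close>

definition variable_tuples :: "nat \<Rightarrow> nat \<Rightarrow> nat \<Rightarrow> (nat \<Rightarrow> nat list \<Rightarrow> nat) set" where
  "variable_tuples M N V = {\<omega> \<in> tree_tuples M N V. V_variable_tuple M V \<omega>}"

lemma variable_tuples_nonempty:
  assumes "N \<ge> 1" "V \<ge> 1"
  shows "variable_tuples M N V \<noteq> {}"
proof -
  \<comment> \<open>Every subtree of a constant tree is the tree itself, so each level contributes
    at most one subtree.\<close>
  define \<tau> where "\<tau> = (\<lambda>i\<in>addresses M. 1 :: nat)"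
  define \<omega> where "\<omega> = (\<lambda>v\<in>{1..V}. \<tau>)"
  have "\<tau> \<in> code_trees M N" using assms by (auto simp: \<tau>_def code_trees_def)
  then have "\<omega> \<in> tree_tuples M N V" by (auto simp: \<omega>_def tree_tuples_def)
  moreover have "card (component_subtrees M V \<omega> k) \<le> V" for k
  proof -
    have "subtree M (\<omega> v) i = \<tau>" if "v \<in> {1..V}" "i \<in> addresses M" for v i
      using that by (auto simp: \<omega>_def \<tau>_def subtree_def)
    then have "component_subtrees M V \<omega> k \<subseteq> {\<tau>}"
      by (auto simp: component_subtrees_conv_image)
    from card_mono[OF _ this] show ?thesis using assms by simp
  qed
  ultimately show ?thesis by (auto simp: variable_tuples_def V_variable_tuple_iff)
qed

text \<open>The number of distinct subtrees at a fixed level is lower semicontinuous: finitely many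
  distinct subtrees are separated by finitely many labels, and every tuple sharing those labels
  keeps them distinct. This is what makes the variable tuples a closed set.\<close>

lemma card_component_subtrees_agree:
  obtains L where "\<And>\<kappa>. agree_below M V L \<omega> \<kappa> \<Longrightarrow>
    card (component_subtrees M V \<omega> k) \<le> card (component_subtrees M V \<kappa> k)"
proof -
  define A where "A = {1..V} \<times> {i \<in> addresses M. length i = k}"
  define s where "s = (\<lambda>\<omega> (v :: nat, i). subtree M (\<omega> v) i)"
  have img: "component_subtrees M V \<kappa> k = s \<kappa> ` A" for \<kappa>
    unfolding component_subtrees_conv_image A_def s_def by simp
  \<comment> \<open>\<open>B\<close> holds exactly one index pair for each distinct subtree of
    \<open>\<omega>\<close> at level \<open>k\<close>.\<close>
  obtain B where B: "B \<subseteq> A" "inj_on (s \<omega>) B" "s \<omega> ` A = s \<omega> ` B"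
    using subset_image_inj[of "s \<omega> ` A" "s \<omega>" A] by auto
  have "finite {i \<in> addresses M. length i = k}"
    by (rule finite_subset[OF _ finite_addresses_below[of M "Suc k"]]) auto
  then have "finite B" using B(1) unfolding A_def by (auto intro: finite_subset)
  \<comment> \<open>Subtrees are restricted to \<open>addresses M\<close>, so two of them that agree
    on all addresses are equal.\<close>
  have "\<exists>j\<in>addresses M. s \<omega> p j \<noteq> s \<omega> q j" if "p \<in> B" "q \<in> B" "p \<noteq> q" for p q
  proof (rule ccontr)
    assume "\<not> ?thesis"
    then have "s \<omega> p = s \<omega> q" by (auto simp: s_def subtree_def fun_eq_iff split: prod.splits)
    with B(2) that show False by (auto dest: inj_onD)
  qed
  then obtain j where j: "\<And>p q. \<lbrakk>p \<in> B; q \<in> B; p \<noteq> q\<rbrakk> \<Longrightarrow>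
      j p q \<in> addresses M \<and> s \<omega> p (j p q) \<noteq> s \<omega> q (j p q)"
    by metis
  \<comment> \<open>Address \<open>j p q\<close> inside a subtree at level \<open>k\<close> lies at
    depth \<open>k + length (j p q)\<close> of the whole tree; \<open>Suc\<close> is there because
    \<open>agree_below\<close> is strict.\<close>
  define L where "L = Suc (k + Max ((\<lambda>(p, q). length (j p q)) ` (B \<times> B)))"
  have L: "k + length (j p q) < L" if "p \<in> B" "q \<in> B" for p q
    using that \<open>finite B\<close> unfolding L_def by (auto simp: less_Suc_eq_le intro!: Max_ge)
  show ?thesis
  proof (rule that)
    fix \<kappa> assume agree: "agree_below M V L \<omega> \<kappa>"
    have eq: "s \<kappa> p i = s \<omega> p i" if "p \<in> B" "i \<in> addresses M" "k + length i < L" for p i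
      using that B(1) agree by (auto simp: s_def subtree_def A_def agree_below_def)
    have "inj_on (s \<kappa>) B"
    proof (rule inj_onI, rule ccontr)
      fix p q assume pq: "p \<in> B" "q \<in> B" "p \<noteq> q" and "s \<kappa> p = s \<kappa> q"
      then have "s \<omega> p (j p q) = s \<omega> q (j p q)"
        using eq[OF pq(1)] eq[OF pq(2)] j[OF pq] L[OF pq(1,2)] by metis
      with j[OF pq] show False by blast
    qed
    then have "card (s \<omega> ` B) = card (s \<kappa> ` B)" using B(2) by (simp add: card_image)
    also have "\<dots> \<le> card (component_subtrees M V \<kappa> k)"
      using B(1) by (intro card_mono finite_component_subtrees) (auto simp: img)
    finally show "card (component_subtrees M V \<omega> k) \<le> card (component_subtrees M V \<kappa> k)"
      by (simp add: img B(3))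
  qed
qed

text \<open>A limit with more than \<open>V\<close> subtrees at some level would pass this excess on
  to an approximating variable tuple. So the set is closed in a compact space.\<close>

lemma compactin_variable_tuples:
  assumes "M \<ge> 2" "V \<ge> 1"
  shows "compactin (Metric_space.mtopology (tree_tuples M N V) (tuple_dist M V)) (variable_tuples M N V)"
proof (rule closedin_compact_space[OF compact_space_tree_tuples[OF assms]])
  have "variable_tuples M N V \<subseteq> tree_tuples M N V" by (auto simp: variable_tuples_def)
  moreover have "\<omega> \<in> variable_tuples M N V"
    if w: "\<omega> \<in> tree_tuples M N V" and approx: "\<forall>k. \<exists>\<kappa>\<in>variable_tuples M N V. agree_below M V k \<omega> \<kappa>" for \<omega>
  proof -
    have "card (component_subtrees M V \<omega> k) \<le> V" for k
    proof -
      obtain L where L: "\<And>\<kappa>. agree_below M V L \<omega> \<kappa> \<Longrightarrow>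
          card (component_subtrees M V \<omega> k) \<le> card (component_subtrees M V \<kappa> k)"
        using card_component_subtrees_agree by blast
      obtain \<kappa> where "\<kappa> \<in> variable_tuples M N V" "agree_below M V L \<omega> \<kappa>" using approx by blast
      then show ?thesis
        using L[of \<kappa>] by (auto simp: variable_tuples_def V_variable_tuple_iff intro: order_trans)
    qed
    then show ?thesis using w by (simp add: variable_tuples_def V_variable_tuple_iff)
  qed
  ultimately show "closedin (Metric_space.mtopology (tree_tuples M N V) (tuple_dist M V)) (variable_tuples M N V)"
    using closedin_tree_tuples_iff[OF assms] by blast
qed

section \<open>Invariance of the variable tuples under the iterated function system\<close>

lemma eta_in_variable_tuples:
  assumes a: "a \<in> ifs_indices M N V" and w: "\<omega> \<in> variable_tuples M N V"
  shows "eta M V a \<omega> \<in> variable_tuples M N V"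
proof -
  have "card (component_subtrees M V (eta M V a \<omega>) k) \<le> V" for k
  proof (cases k)
    case 0
    then show ?thesis by (simp add: card_component_subtrees_0)
  next
    case (Suc l)
    have "card (component_subtrees M V (eta M V a \<omega>) (Suc l)) \<le> card (component_subtrees M V \<omega> l)"
      by (intro card_mono finite_component_subtrees component_subtrees_eta[OF a])
    also have "\<dots> \<le> V" using w by (simp add: variable_tuples_def V_variable_tuple_iff)
    finally show ?thesis using Suc by simp
  qed
  then show ?thesis
    using eta_in_tree_tuples[OF a] w by (simp add: variable_tuples_def V_variable_tuple_iff)
qed

text \<open>At most \<open>V\<close> distinct subtrees occur at level 1, so they fit into the
  \<open>V\<close> components of a new tuple \<open>\<omega>'\<close>. The index \<open>a\<close>
  records the root labels of \<open>\<omega>\<close> and the slot in which each of these subtrees is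
  stored.\<close>

lemma variable_tuple_eq_eta:
  assumes "M \<ge> 1" "V \<ge> 1" and w: "\<omega> \<in> variable_tuples M N V"
  obtains a \<omega>' where "a \<in> ifs_indices M N V" "\<omega>' \<in> variable_tuples M N V" "\<omega> = eta M V a \<omega>'"
proof -
  define D where "D = component_subtrees M V \<omega> 1"
  have wX: "\<omega> \<in> tree_tuples M N V" and card: "card (component_subtrees M V \<omega> k) \<le> V" for k
    using w by (auto simp: variable_tuples_def V_variable_tuple_iff)
  have D_iff: "t \<in> D \<longleftrightarrow> (\<exists>v\<in>{1..V}. \<exists>m\<in>{1..M}. t = subtree M (\<omega> v) [m])" for t
    unfolding D_def component_subtrees_conv_image by (fastforce simp: length_Suc_conv)
  have "D \<noteq> {}" using D_iff assms(1,2) by (metis atLeastAtMost_iff empty_iff order_refl)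
  \<comment> \<open>\<open>h\<close> assigns each level-1 subtree its own slot, which is possible by
    variability at level 1.\<close>
  obtain h where h: "h ` D \<subseteq> {1..V}" "inj_on h D"
    using card_le_inj[of D "{1..V}"] card[of 1] by (auto simp: D_def finite_component_subtrees)
  \<comment> \<open>Slots outside the range of \<open>h\<close> repeat some element of
    \<open>D\<close>, so that \<open>\<omega>'\<close> has no subtrees foreign to
    \<open>\<omega>\<close>.\<close>
  define f where "f = (\<lambda>v. if v \<in> h ` D then inv_into D h v else SOME t. t \<in> D)"
  have f_in: "f v \<in> D" for v
    using \<open>D \<noteq> {}\<close> by (auto simp: f_def inv_into_into some_in_eq)
  have f_h: "f (h t) = t" if "t \<in> D" for t
    using that h(2) by (simp add: f_def)
  define \<omega>' where "\<omega>' = restrict f {1..V}"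
  define a where "a = (\<lambda>v\<in>{1..V}. (\<omega> v [], \<lambda>m\<in>{1..M}. h (subtree M (\<omega> v) [m])))"
  have D_trees: "t \<in> code_trees M N" if "t \<in> D" for t
    using that tree_tuples_component[OF wX] by (auto simp: D_iff intro!: subtree_in_code_trees)
  have w'X: "\<omega>' \<in> tree_tuples M N V"
    using f_in D_trees by (auto simp: \<omega>'_def tree_tuples_def)
  have root: "\<omega> v [] \<in> {1..N}" if "v \<in> {1..V}" for v
    using tree_tuples_component[OF wX that] unfolding code_trees_def by (rule PiE_mem) simp
  have in_D: "subtree M (\<omega> v) [m] \<in> D" if "v \<in> {1..V}" "m \<in> {1..M}" for v m
    using that D_iff by blast
  have a: "a \<in> ifs_indices M N V"
    unfolding ifs_indices_def a_def using root h(1) in_D by (fastforce simp: restrict_PiE_iff)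
  \<comment> \<open>Each component of \<open>\<omega>'\<close> is a level-1 subtree of
    \<open>\<omega>\<close>, so the bound at level \<open>Suc k\<close> for \<open>\<omega>\<close>
    gives the bound at level \<open>k\<close> for \<open>\<omega>'\<close>.\<close>
  have "component_subtrees M V \<omega>' k \<subseteq> component_subtrees M V \<omega> (Suc k)" for k
  proof
    fix t assume "t \<in> component_subtrees M V \<omega>' k"
    then obtain v i where i: "i \<in> addresses M" "length i = k" "t = subtree M (f v) i"
      by (auto simp: component_subtrees_conv_image \<omega>'_def)
    obtain u m where um: "u \<in> {1..V}" "m \<in> {1..M}" "f v = subtree M (\<omega> u) [m]"
      using f_in D_iff by blast
    have "t = subtree M (\<omega> u) (m # i)" using i um by (simp add: subtree_subtree)
    with i um show "t \<in> component_subtrees M V \<omega> (Suc k)"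
      unfolding component_subtrees_conv_image by (auto intro!: image_eqI[of _ _ "(u, m # i)"])
  qed
  then have "card (component_subtrees M V \<omega>' k) \<le> V" for k
    using card_mono[OF finite_component_subtrees] card order_trans by metis
  then have "\<omega>' \<in> variable_tuples M N V"
    using w'X by (simp add: variable_tuples_def V_variable_tuple_iff)
  moreover have "\<omega> = eta M V a \<omega>'"
  proof (rule PiE_ext[OF wX[unfolded tree_tuples_def] eta_in_tree_tuples[OF a w'X, unfolded tree_tuples_def]])
    fix v assume v: "v \<in> {1..V}"
    show "\<omega> v = eta M V a \<omega>' v"
    proof (rule PiE_ext)
      show "\<omega> v \<in> addresses M \<rightarrow>\<^sub>E {1..N}" "eta M V a \<omega>' v \<in> addresses M \<rightarrow>\<^sub>E {1..N}"
        using tree_tuples_component[OF wX v] tree_tuples_component[OF eta_in_tree_tuples[OF a w'X] v]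
        by (simp_all add: code_trees_def)
      fix i assume i: "i \<in> addresses M"
      show "\<omega> v i = eta M V a \<omega>' v i"
      proof (cases i)
        case Nil
        then show ?thesis using v by (simp add: eta_Nil a_def)
      next
        case (Cons m j)
        with i have mj: "m \<in> {1..M}" "j \<in> addresses M" by auto
        have "h (subtree M (\<omega> v) [m]) \<in> {1..V}" using h(1) in_D[OF v mj(1)] by blast
        then have "\<omega>' (snd (a v) m) = subtree M (\<omega> v) [m]"
          using v mj in_D[OF v mj(1)] by (simp add: a_def \<omega>'_def f_h)
        then show ?thesis using Cons v mj by (simp add: eta_Cons subtree_def)
      qed
    qed
  qed
  ultimately show ?thesis using that a by blast
qed

section \<open>Contraction and uniqueness of the compact invariant set\<close>

text \<open>The contraction property with factor \<open>1 / M\<close>, in terms of labels: root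
  labels of the image come from \<open>a\<close> alone, and all other labels move one level
  down.\<close>

lemma agree_below_eta:
  assumes a: "a \<in> ifs_indices M N V" and "agree_below M V k \<omega> \<kappa>"
  shows "agree_below M V (Suc k) (eta M V a \<omega>) (eta M V a \<kappa>)"
  unfolding agree_below_def
proof (intro ballI impI)
  fix v i assume v: "v \<in> {1..V}" and i: "i \<in> addresses M" "length i < Suc k"
  show "eta M V a \<omega> v i = eta M V a \<kappa> v i"
  proof (cases i)
    case Nil
    then show ?thesis using v by (simp add: eta_Nil)
  next
    case (Cons m j)
    then show ?thesis
      using v i ifs_indices_mem(2)[OF a v, of m] assms(2) by (simp add: eta_Cons agree_below_def)
  qed
qed

text \<open>Both inclusions use induction on the level. The first unfolds the invariance of
  \<open>K\<close>; the second unfolds variable tuples by \<open>variable_tuple_eq_eta\<close> and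
  transports approximants from \<open>K\<close> along the same maps.\<close>

lemma invariant_compact_eq_variable_tuples:
  assumes M: "M \<ge> 2" and V: "V \<ge> 1" and "K \<noteq> {}"
    and cpt: "compactin (Metric_space.mtopology (tree_tuples M N V) (tuple_dist M V)) K"
    and inv: "K = (\<Union>a\<in>ifs_indices M N V. eta M V a ` K)"
  shows "K = variable_tuples M N V"
proof
  interpret Metric_space "tree_tuples M N V" "tuple_dist M V"
    using assms by (intro Metric_space_tree_tuples)
  have sub: "K \<subseteq> tree_tuples M N V" using compactin_subset_topspace[OF cpt] by simp
  show "K \<subseteq> variable_tuples M N V"
  proof
    fix \<omega> assume w: "\<omega> \<in> K"
    have "card (component_subtrees M V \<omega> k) \<le> V" for k
      using w
    proof (induction k arbitrary: \<omega>)
      case 0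
      show ?case by (rule card_component_subtrees_0)
    next
      case (Suc k)
      obtain a \<kappa> where a: "a \<in> ifs_indices M N V" "\<kappa> \<in> K" "\<omega> = eta M V a \<kappa>"
        using inv Suc.prems by blast
      have "card (component_subtrees M V \<omega> (Suc k)) \<le> card (component_subtrees M V \<kappa> k)"
        unfolding a(3) by (intro card_mono finite_component_subtrees component_subtrees_eta[OF a(1)])
      also have "\<dots> \<le> V" by (rule Suc.IH[OF a(2)])
      finally show ?case .
    qed
    then show "\<omega> \<in> variable_tuples M N V"
      using w sub by (auto simp: variable_tuples_def V_variable_tuple_iff)
  qed
  \<comment> \<open>Compact sets are closed in a metric space, so approximation at every level will
    give membership.\<close>
  have closed: "closedin mtopology K"
    using cpt Hausdorff_space_mtopology by (intro compactin_imp_closedin)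
  show "variable_tuples M N V \<subseteq> K"
  proof
    fix \<omega> assume w: "\<omega> \<in> variable_tuples M N V"
    have "\<exists>\<kappa>\<in>K. agree_below M V k \<omega> \<kappa>" for k
      using w
    proof (induction k arbitrary: \<omega>)
      case 0
      then show ?case using \<open>K \<noteq> {}\<close> by (auto simp: agree_below_def)
    next
      case (Suc k)
      obtain a \<omega>' where a: "a \<in> ifs_indices M N V" "\<omega>' \<in> variable_tuples M N V" "\<omega> = eta M V a \<omega>'"
        using variable_tuple_eq_eta[OF _ V Suc.prems] M by auto
      obtain \<kappa> where "\<kappa> \<in> K" "agree_below M V k \<omega>' \<kappa>" using Suc.IH[OF a(2)] by blast
      \<comment> \<open>The approximant is \<open>eta M V a \<kappa>\<close>, with the same
        \<open>a\<close> that produces \<open>\<omega>\<close>; it lies in \<open>K\<close> by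
        invariance.\<close>
      then show ?case using agree_below_eta[OF a(1)] a inv by blast
    qed
    moreover have "\<omega> \<in> tree_tuples M N V" using w by (simp add: variable_tuples_def)
    ultimately show "\<omega> \<in> K" using closed closedin_tree_tuples_iff[OF M V sub] by blast
  qed
qed

text \<open>Supplies existence and uniqueness for the definite description in
  \<open>ifs_attractor\<close>.\<close>

lemma Omega_V_eq_variable_tuples:
  assumes "M \<ge> 2" "N \<ge> 1" "V \<ge> 1"
  shows "Omega_V M N V = variable_tuples M N V"
  unfolding Omega_V_def ifs_attractor_def
proof (rule the_equality, intro conjI)
  show "variable_tuples M N V \<noteq> {}" using assms by (intro variable_tuples_nonempty)
  show "compactin (Metric_space.mtopology (tree_tuples M N V) (tuple_dist M V)) (variable_tuples M N V)"
    using assms by (intro compactin_variable_tuples)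
  show "variable_tuples M N V = (\<Union>a\<in>ifs_indices M N V. eta M V a ` variable_tuples M N V)"
  proof
    show "variable_tuples M N V \<subseteq> (\<Union>a\<in>ifs_indices M N V. eta M V a ` variable_tuples M N V)"
    proof
      fix \<omega> assume "\<omega> \<in> variable_tuples M N V"
      then obtain a \<omega>' where "a \<in> ifs_indices M N V" "\<omega>' \<in> variable_tuples M N V" "\<omega> = eta M V a \<omega>'"
        using variable_tuple_eq_eta[of M V \<omega> N] assms by auto
      then show "\<omega> \<in> (\<Union>a\<in>ifs_indices M N V. eta M V a ` variable_tuples M N V)" by blast
    qed
  qed (auto intro: eta_in_variable_tuples)
next
  fix K
  assume "K \<noteq> {} \<and> compactin (Metric_space.mtopology (tree_tuples M N V) (tuple_dist M V)) K \<and>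
    K = (\<Union>a\<in>ifs_indices M N V. eta M V a ` K)"
  then show "K = variable_tuples M N V"
    using assms by (intro invariant_compact_eq_variable_tuples) simp_all
qed

theorem theorem11:
  fixes M N V :: nat
  assumes "M \<ge> 2" and "N \<ge> 1" and "V \<ge> 1"
  shows "(\<forall>\<omega>\<in>tree_tuples M N V. \<omega> \<in> Omega_V M N V \<longleftrightarrow> V_variable_tuple M V \<omega>) \<and>
         (\<forall>\<sigma>\<in>code_trees M N. \<sigma> \<in> V_trees M N V \<longleftrightarrow> V_variable_tree M V \<sigma>)"
proof (intro conjI ballI)
  fix \<omega> assume "\<omega> \<in> tree_tuples M N V"
  then show "\<omega> \<in> Omega_V M N V \<longleftrightarrow> V_variable_tuple M V \<omega>"
    by (simp add: Omega_V_eq_variable_tuples[OF assms] variable_tuples_def)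
next
  fix \<sigma> assume s: "\<sigma> \<in> code_trees M N"
  show "\<sigma> \<in> V_trees M N V \<longleftrightarrow> V_variable_tree M V \<sigma>"
  proof
    assume "\<sigma> \<in> V_trees M N V"
    then obtain \<omega> where w: "V_variable_tuple M V \<omega>" "\<sigma> = \<omega> 1"
      by (auto simp: V_trees_def Omega_V_eq_variable_tuples[OF assms] variable_tuples_def)
    \<comment> \<open>The first component contributes only some of the subtrees counted for the
      tuple; \<open>V \<ge> 1\<close> makes 1 a valid component.\<close>
    have "subtrees_at_level M \<sigma> k \<subseteq> component_subtrees M V \<omega> k" for k
      using assms(3) by (auto simp: w(2) component_subtrees_def)
    then show "V_variable_tree M V \<sigma>"
      using w(1) card_mono[OF finite_component_subtrees] order_trans
      unfolding V_variable_tuple_iff V_variable_tree_def by metis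
  next
    assume var: "V_variable_tree M V \<sigma>"
    \<comment> \<open>Repeating \<open>\<sigma>\<close> in all components adds no subtrees, so the
      tuple is variable and has \<open>\<sigma>\<close> as its first component.\<close>
    define \<omega> where "\<omega> = (\<lambda>v\<in>{1..V}. \<sigma>)"
    have "component_subtrees M V \<omega> k = subtrees_at_level M \<sigma> k" for k
      using assms(3) by (auto simp: component_subtrees_def \<omega>_def)
    then have "\<omega> \<in> variable_tuples M N V"
      using s var
      by (auto simp: variable_tuples_def V_variable_tuple_iff V_variable_tree_def \<omega>_def tree_tuples_def)
    moreover have "\<sigma> = \<omega> 1" using assms(3) by (simp add: \<omega>_def)
    ultimately show "\<sigma> \<in> V_trees M N V"
      by (auto simp: V_trees_def Omega_V_eq_variable_tuples[OF assms])
  qed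
qed

end
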